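(* Assume (A1)–(A5), let $(y_n)$ be the iterates with adapted step sizes $y_{n+1}=y_n+a^\omega(n)[h(y_n)+M_{n+1}]$, $a^\omega(n)=a(n)/g(y_n)$ (all as specified in the context). Then almost surely $a^\omega(n)=a(n)$ for all except finitely many $n$. In particular, $\sum_n a^\omega(n)=\infty$ almost surely.
   Context: Setting. $h:\mathbb R^d\to\mathbb R^d$, $(a(n))_{n\ge0}$ are positive deterministic step sizes, $W:\mathbb R^d\to[0,\infty)$ is continuously differentiable, and $y_0$ is an $\mathbb R^d$-valued random vector. $(M_n)_{n\ge1}$ are $\mathbb R^d$-valued random vectors, and $\mathcal F_n=\sigma(y_0,M_1,\dots,M_n)$. (A1) $h$ is locally Lipschitz. (A2) (i) $\sum_n a(n)=\infty$; (ii) $\sum_n a(n)^2<\infty$. (A3) (i) $E[M_{n+1}\mid\mathcal F_n]=0$ a.s. for all $n\ge0$; (ii) each $M_n$ is square integrable and there is a locally bounded measurable $f:\mathbb R^d\to[0,\infty)$ with $E[\|M_{n+1}\|^2\mid\mathcal F_n]\le f(y_n)$ a.s. for all $n\ge0$. (A4) (i) $W\ge0$ and $W(x)\to\infty$ as $\|x\|\to\infty$; (ii) $M$ is a positive integer such that $h(x)\cdot\nabla W(x)<0$ whenever $W(x)\ge M$. (A5) $W$ is twice continuously differentiable and all its second order derivatives are bounded in absolute value by a constant. For real $r$, $H^r:=\{x:W(x)<r\}$ and $\bar H^r$ is its closure; $H^\infty=\bar H^\infty=\mathbb R^d$. Choice of $N$ and $g$. $N$ is a positive integer or $\infty$, with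 $M<N\le\infty$, such that there is a finite constant $c_N>\max\left(1,\sup_{y\in\bar H^N\setminus H^M}\frac{\|h(y)\|^2+f(y)}{W(y)}\right)$ (this always holds for finite $N$). $g:\mathbb R^d\to\mathbb R$ is a locally bounded measurable function with $g(y)\ge\max\left(1,\ \mathbb I\{W(y)>N\}\sqrt{\frac{\|h(y)\|^2+f(y)}{W(y)}}\right)$ for all $y$ (the second term being $0$ when $W(y)\le N$), and moreover $g(y)=1$ for all $y\in H^N$. Iterates: $y_{n+1}=y_n+a^\omega(n)[h(y_n)+M_{n+1}]$ for $n\ge0$, where $a^\omega(n):=a(n)/g(y_n)$. *)

theory Defs
  imports "HOL-Probability.Probability"
begin

definition partial_deriv :: "'a::euclidean_space \<Rightarrow> ('a \<Rightarrow> real) \<Rightarrow> 'a \<Rightarrow> real"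
  where "partial_deriv b f x = deriv (\<lambda>t. f (x + t *\<^sub>R b)) 0"

definition grad :: "('a::euclidean_space \<Rightarrow> real) \<Rightarrow> 'a \<Rightarrow> 'a"
  where "grad f x = (\<Sum>b\<in>Basis. partial_deriv b f x *\<^sub>R b)"

definition continuously_differentiable ::
    "('a::euclidean_space \<Rightarrow> 'b::real_normed_vector) \<Rightarrow> bool"
  where "continuously_differentiable f \<longleftrightarrow>
    (\<exists>f' :: 'a \<Rightarrow> 'a \<Rightarrow>\<^sub>L 'b.
      (\<forall>x. (f has_derivative blinfun_apply (f' x)) (at x)) \<and> continuous_on UNIV f')"

definition twice_continuously_differentiable :: "('a::euclidean_space \<Rightarrow> real) \<Rightarrow> bool"
  where "twice_continuously_differentiable f \<longleftrightarrow>
    continuously_differentiable f \<and> continuously_differentiable (grad f)"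

definition locally_lipschitz :: "('a::metric_space \<Rightarrow> 'b::metric_space) \<Rightarrow> bool"
  where "locally_lipschitz f \<longleftrightarrow> (\<forall>x. \<exists>e>0. \<exists>L. L-lipschitz_on (ball x e) f)"

definition locally_bounded :: "('a::metric_space \<Rightarrow> 'b::metric_space) \<Rightarrow> bool"
  where "locally_bounded f \<longleftrightarrow> (\<forall>x. \<exists>e>0. bounded (f ` ball x e))"

(* The bound is an extended real, so that sublevel W \<infinity> is the whole space. *)
definition sublevel :: "('a \<Rightarrow> real) \<Rightarrow> ereal \<Rightarrow> 'a set"
  where "sublevel W r = {x. ereal (W x) < r}"

(* The sigma-algebra generated by y0, M 1, ..., M n; the value M 0 is not used. *)
definition noise_filtration ::
    "'w measure \<Rightarrow> ('w \<Rightarrow> 'a::topological_space) \<Rightarrow> (nat \<Rightarrow> 'w \<Rightarrow> 'a) \<Rightarrow> nat \<Rightarrow> 'w measure"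
  where "noise_filtration P y0 M n =
    sigma (space P)
      ({y0 -` B \<inter> space P |B. B \<in> sets borel} \<union>
       {M k -` B \<inter> space P |k B. k \<in> {1..n} \<and> B \<in> sets borel})"

(* The library provides conditional expectations of real-valued functions only;
   those of vector-valued functions are taken coordinatewise. *)
definition vector_cond_exp ::
    "'w measure \<Rightarrow> 'w measure \<Rightarrow> ('w \<Rightarrow> 'a::euclidean_space) \<Rightarrow> 'w \<Rightarrow> 'a"
  where "vector_cond_exp P F X \<omega> = (\<Sum>b\<in>Basis. real_cond_exp P F (\<lambda>v. X v \<bullet> b) \<omega> *\<^sub>R b)"

end

theory Submission
  imports Defs
begin

text \<open>The Lyapunov function is V = ln (1 + W). Because V grows only logarithmically and
  (|h|^2 + f) / g^2 is bounded by a multiple of 1 + W, both the martingale part of the increments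
  of V and their second-order remainders have second, respectively first, moments bounded by a
  multiple of a(n)^2, whatever the distribution of the initial value. Hence both series converge
  almost surely, and what remains is a pathwise argument: up to a convergent perturbation, V
  decreases along the drift outside the sublevel set at height m, so the iterates enter that set
  and eventually stay below height N, where g = 1.\<close>

section \<open>Gradients and descent\<close>

text \<open>No moment of \<open>y 0\<close> is assumed, so the expectations of \<open>W\<close> and
  of V along the iterates need not be finite; only increments can be estimated. The estimate rests
  on a cancellation: a nonnegative \<open>W\<close> with \<open>L\<close>-Lipschitz gradient
  satisfies |grad W|^2 <= 4 L W, so the gradient of V has squared norm at most 4 L / (1 + W). Up to
  a constant, this is the reciprocal of the growth that division by \<open>g\<close> leaves in the
  drift and in the noise variance. A second obstacle is that the adapted steps might be summable,
  since \<open>g\<close> can be large far out. But once the perturbation is known to converge, V is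
  bounded along any path that stays outside the inner level set. Such a path remains in a compact
  band, where \<open>g\<close> is bounded and the adapted step is comparable to \<open>a n\<close>;
  divergence of the original steps then contradicts V >= 0. All this concerns finite
  \<open>N\<close>.\<close>

lemma continuously_differentiable_imp_continuous_on:
  assumes "continuously_differentiable f"
  shows "continuous_on S f"
proof -
  obtain f' where "\<And>x. (f has_derivative blinfun_apply (f' x)) (at x)"
    using assms unfolding continuously_differentiable_def by blast
  then have "\<And>x. isCont f x" by (rule has_derivative_continuous)
  then show ?thesis by (simp add: continuous_at_imp_continuous_on)
qed

lemma partial_deriv_eq:
  fixes f :: "'a::euclidean_space \<Rightarrow> real"
  assumes "(f has_derivative f') (at x)"
  shows "partial_deriv b f x = f' b"
proof -
  have 1: "(f has_derivative f') (at (x + 0 *\<^sub>R b) within UNIV)" using assms by simp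
  have 2: "((\<lambda>t. x + t *\<^sub>R b) has_derivative (\<lambda>t. t *\<^sub>R b)) (at 0)"
    by (auto intro!: derivative_eq_intros)
  have "((\<lambda>t. f (x + t *\<^sub>R b)) has_derivative (\<lambda>t. f' (t *\<^sub>R b))) (at 0)"
    using has_derivative_compose[OF 2 1] by simp
  moreover have "(\<lambda>t. f' (t *\<^sub>R b)) = (\<lambda>t. f' b * t)"
    using linear_scale[OF has_derivative_linear[OF assms]] by (auto simp: mult.commute)
  ultimately have "((\<lambda>t. f (x + t *\<^sub>R b)) has_field_derivative f' b) (at 0)"
    by (simp add: has_field_derivative_def)
  then show ?thesis unfolding partial_deriv_def by (rule DERIV_imp_deriv)
qed

text \<open>A linear functional is determined by its values on the basis, and there the total
  derivative takes the partial derivatives as values.\<close>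

lemma has_derivative_grad:
  fixes f :: "'a::euclidean_space \<Rightarrow> real"
  assumes "continuously_differentiable f"
  shows "(f has_derivative (\<lambda>v. grad f x \<bullet> v)) (at x)"
proof -
  obtain f' where f': "\<And>x. (f has_derivative blinfun_apply (f' x)) (at x)"
    using assms unfolding continuously_differentiable_def by blast
  have "blinfun_apply (f' x) v = grad f x \<bullet> v" for v
  proof -
    have "blinfun_apply (f' x) v = f' x (\<Sum>b\<in>Basis. (v \<bullet> b) *\<^sub>R b)"
      by (simp add: euclidean_representation)
    also have "\<dots> = (\<Sum>b\<in>Basis. (v \<bullet> b) * f' x b)"
      by (simp add: blinfun.sum_right blinfun.scaleR_right)
    also have "\<dots> = grad f x \<bullet> v"
      by (simp add: grad_def partial_deriv_eq[OF f'] inner_sum_left inner_commute[of _ v] inner_sum_right mult.commute)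
    finally show ?thesis .
  qed
  then have "blinfun_apply (f' x) = (\<lambda>v. grad f x \<bullet> v)" by (rule ext)
  then show ?thesis using f'[of x] by simp
qed

text \<open>Entrywise bounds on the Hessian bound its operator norm, crudely by an l1 estimate over
  all pairs of basis vectors, and the mean value inequality then applies to the gradient.\<close>

lemma grad_lipschitz:
  fixes f :: "'a::euclidean_space \<Rightarrow> real"
  assumes "continuously_differentiable (grad f)"
    and "\<And>x i j. i \<in> Basis \<Longrightarrow> j \<in> Basis \<Longrightarrow> \<bar>partial_deriv i (partial_deriv j f) x\<bar> \<le> C"
  obtains L where "L > 0" "\<And>x y. norm (grad f x - grad f y) \<le> L * norm (x - y)"
proof -
  obtain G where G: "\<And>x. (grad f has_derivative blinfun_apply (G x)) (at x)"
    using assms(1) unfolding continuously_differentiable_def by blast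
  define L where "L = (\<Sum>i\<in>(Basis::'a set). \<Sum>j\<in>(Basis::'a set). \<bar>C\<bar>)"
  have entry: "\<bar>G x i \<bullet> j\<bar> \<le> \<bar>C\<bar>" if "i \<in> Basis" "j \<in> Basis" for x i j
  proof -
    \<comment> \<open>Coordinate \<open>j\<close> of the gradient is a partial derivative, so the
      iterated partials are the matrix entries of \<open>G x\<close>.\<close>
    have "partial_deriv j f = (\<lambda>x. grad f x \<bullet> j)"
      using that by (auto simp: grad_def)
    moreover have "((\<lambda>x. grad f x \<bullet> j) has_derivative (\<lambda>v. G x v \<bullet> j)) (at x)"
      using has_derivative_inner_left[OF G] .
    ultimately have "partial_deriv i (partial_deriv j f) x = G x i \<bullet> j"
      using partial_deriv_eq by metis
    then show ?thesis using assms(2)[OF that, of x] by simp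
  qed
  have "norm (G x v) \<le> L * norm v" for x v
  proof -
    have "norm (G x v) = norm (G x (\<Sum>i\<in>Basis. (v \<bullet> i) *\<^sub>R i))"
      by (simp add: euclidean_representation)
    also have "\<dots> = norm (\<Sum>i\<in>Basis. (v \<bullet> i) *\<^sub>R G x i)"
      by (simp add: blinfun.sum_right blinfun.scaleR_right)
    also have "\<dots> \<le> (\<Sum>i\<in>Basis. norm ((v \<bullet> i) *\<^sub>R G x i))" by (rule norm_sum)
    also have "\<dots> \<le> (\<Sum>i\<in>(Basis::'a set). norm v * (\<Sum>j\<in>(Basis::'a set). \<bar>C\<bar>))"
    proof (rule sum_mono)
      fix i :: 'a assume i: "i \<in> Basis"
      have "norm (G x i) \<le> (\<Sum>j\<in>Basis. \<bar>G x i \<bullet> j\<bar>)" by (rule norm_le_l1)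
      also have "\<dots> \<le> (\<Sum>j\<in>(Basis::'a set). \<bar>C\<bar>)" by (intro sum_mono entry i)
      finally show "norm ((v \<bullet> i) *\<^sub>R G x i) \<le> norm v * (\<Sum>j\<in>(Basis::'a set). \<bar>C\<bar>)"
        by (simp add: Basis_le_norm i mult_mono)
    qed
    also have "\<dots> = L * norm v" by (simp add: L_def)
    finally show ?thesis .
  qed
  then have on: "onorm (G x) \<le> L" for x by (rule onorm_bound[rotated]) (simp add: L_def sum_nonneg)
  have "norm (grad f x - grad f y) \<le> L * norm (x - y)" for x y
    by (rule differentiable_bound[of UNIV]) (use G on in auto)
  \<comment> \<open>The extra 1 makes the constant strictly positive even for a vanishing Hessian;
    it later serves as a divisor.\<close>
  moreover have "L * norm (x - y) \<le> (L + 1) * norm (x - y)" for x y :: 'a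
    by (simp add: mult_right_mono)
  ultimately have "norm (grad f x - grad f y) \<le> (L + 1) * norm (x - y)" for x y
    by (rule order_trans)
  moreover have "L \<ge> 0" by (simp add: L_def sum_nonneg)
  ultimately show ?thesis by (intro that[of "L + 1"]) auto
qed

text \<open>By the mean value theorem on the segment, the increment is given by the gradient at one
  intermediate point; moving that gradient back to \<open>x\<close> costs at most \<open>L\<close>
  times the squared length. Integration would give \<open>L / 2\<close>, but the factor is
  immaterial.\<close>

lemma descent_lemma:
  fixes f :: "'a::euclidean_space \<Rightarrow> real"
  assumes f: "continuously_differentiable f"
    and L: "\<And>x y. norm (grad f x - grad f y) \<le> L * norm (x - y)"
  shows "f (x + d) \<le> f x + grad f x \<bullet> d + L * (norm d)\<^sup>2"
proof -
  \<comment> \<open>The sign of \<open>L\<close> is not assumed, but this product bounds a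
    norm.\<close>
  have L0: "L * norm d \<ge> 0" using order_trans[OF norm_ge_zero L[of d 0]] by simp
  have 1: "((\<lambda>t::real. f (x + t *\<^sub>R d)) has_derivative (\<lambda>s. grad f (x + t *\<^sub>R d) \<bullet> (s *\<^sub>R d))) (at t)" for t
  proof -
    have "((\<lambda>t::real. x + t *\<^sub>R d) has_derivative (\<lambda>s. s *\<^sub>R d)) (at t)"
      by (auto intro!: derivative_eq_intros)
    from has_derivative_compose[OF this] has_derivative_grad[OF f, of "x + t *\<^sub>R d"]
    show ?thesis by blast
  qed
  have "\<exists>z. z > 0 \<and> z < (1::real) \<and> f (x + 1 *\<^sub>R d) - f (x + 0 *\<^sub>R d) = (1 - 0) * (grad f (x + z *\<^sub>R d) \<bullet> d)"
  proof (rule MVT2)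
    show "((\<lambda>t. f (x + t *\<^sub>R d)) has_field_derivative grad f (x + t *\<^sub>R d) \<bullet> d) (at t)" for t
      using 1[of t] by (simp add: has_field_derivative_def mult.commute[of _ "grad f (x + t *\<^sub>R d) \<bullet> d"])
  qed simp
  then obtain z where z: "0 < z" "z < 1" "f (x + d) - f x = grad f (x + z *\<^sub>R d) \<bullet> d" by auto
  have "(grad f (x + z *\<^sub>R d) - grad f x) \<bullet> d \<le> norm (grad f (x + z *\<^sub>R d) - grad f x) * norm d"
    by (rule norm_cauchy_schwarz)
  also have "\<dots> \<le> (L * norm (z *\<^sub>R d)) * norm d"
    using L[of "x + z *\<^sub>R d" x] by (intro mult_right_mono) auto
  also have "\<dots> = z * (L * norm d) * norm d" using z by simp
  also have "\<dots> \<le> 1 * (L * norm d) * norm d"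
    using z L0 by (intro mult_right_mono) auto
  finally show ?thesis using z(3) by (simp add: inner_diff_left power2_eq_square)
qed

text \<open>A step against the gradient cannot push \<open>f\<close> below 0, so the guaranteed
  decrease is at most \<open>f x\<close>.\<close>

lemma norm_grad_squared_le:
  fixes f :: "'a::euclidean_space \<Rightarrow> real"
  assumes f: "continuously_differentiable f" and "\<And>x. f x \<ge> 0" and "L > 0"
    and L: "\<And>x y. norm (grad f x - grad f y) \<le> L * norm (x - y)"
  shows "(norm (grad f x))\<^sup>2 \<le> 4 * L * f x"
proof -
  \<comment> \<open>This step length minimises the upper bound \<open>- t + L * t\<^sup>2\<close>
    (times the squared gradient norm), with minimum \<open>- 1 / (4 * L)\<close>.\<close>
  define t where "t = 1 / (2 * L)"
  have "0 \<le> f (x + (- t) *\<^sub>R grad f x)" by fact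
  also have "\<dots> \<le> f x + grad f x \<bullet> ((- t) *\<^sub>R grad f x) + L * (norm ((- t) *\<^sub>R grad f x))\<^sup>2"
    by (rule descent_lemma[OF f L])
  also have "\<dots> = f x - (norm (grad f x))\<^sup>2 / (4 * L)"
    using \<open>L > 0\<close> unfolding t_def
    by (simp add: power_mult_distrib dot_square_norm field_simps) (simp add: power2_eq_square)
  finally show ?thesis using \<open>L > 0\<close> by (simp add: field_simps)
qed

text \<open>Concavity of the logarithm: an upper bound on the increment of \<open>W\<close> passes
  to ln (1 + W) after division by 1 + W, without any second-order expansion of the
  logarithm.\<close>

lemma ln_add_one_le_tangent:
  fixes w w' :: real
  assumes "w \<ge> 0" "w' \<ge> 0"
  shows "ln (1 + w') \<le> ln (1 + w) + (w' - w) / (1 + w)"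
proof -
  have "ln ((1 + w') / (1 + w)) \<le> (1 + w') / (1 + w) - 1"
    using assms by (intro ln_le_minus_one) auto
  then show ?thesis using assms by (simp add: ln_div field_simps)
qed

section \<open>Local bounds and compact sublevel sets\<close>

lemma locally_bounded_imp_bounded_image:
  assumes "locally_bounded f" "compact K"
  shows "bounded (f ` K)"
proof -
  have "\<forall>x. \<exists>e>0. bounded (f ` ball x e)" using assms(1) by (simp add: locally_bounded_def)
  then obtain e where e: "\<And>x. e x > 0" "\<And>x. bounded (f ` ball x (e x))" by metis
  have "K \<subseteq> (\<Union>x\<in>K. ball x (e x))" using e(1) by auto
  then obtain D where D: "D \<subseteq> K" "finite D" "K \<subseteq> (\<Union>x\<in>D. ball x (e x))"
    by (rule compactE_image[OF assms(2), rotated]) auto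
  have "bounded (\<Union>x\<in>D. f ` ball x (e x))" using D e by blast
  then show ?thesis by (rule bounded_subset) (use D(3) in blast)
qed

lemma locally_lipschitz_imp_continuous_on:
  assumes "locally_lipschitz f"
  shows "continuous_on S f"
proof -
  have "isCont f x" for x
  proof -
    obtain e L where "e > 0" "L-lipschitz_on (ball x e) f"
      using assms unfolding locally_lipschitz_def by blast
    then show ?thesis
      using lipschitz_on_continuous_on[of L "ball x e" f]
      by (auto simp: continuous_on_eq_continuous_at)
  qed
  then show ?thesis by (simp add: continuous_at_imp_continuous_on)
qed

lemma compact_sublevel:
  fixes f :: "'a::euclidean_space \<Rightarrow> real"
  assumes "continuous_on UNIV f" "filterlim f at_top at_infinity"
  shows "compact {x. f x \<le> r}"
proof -
  have "eventually (\<lambda>x. f x > r) at_infinity" using assms(2) by (simp add: filterlim_at_top_dense)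
  then obtain b where "\<And>x. norm x \<ge> b \<Longrightarrow> f x > r" by (auto simp: eventually_at_infinity)
  then have "bounded {x. f x \<le> r}" by (intro boundedI[of _ b]) (force simp: not_less[symmetric])
  moreover have "closed {x. f x \<le> r}"
    using assms(1) by (intro closed_Collect_le) auto
  ultimately show ?thesis by (simp add: compact_eq_bounded_closed)
qed

text \<open>Once the noise tails are small, the drift forces an entry below level l; afterwards the
  invariant is that ln (1 + w) exceeds ln (1 + l) by at most one small step plus the noise
  accumulated since the last visit below l.\<close>

lemma perturbed_descent_eventually_less:
  fixes w e \<alpha> q a :: "nat \<Rightarrow> real" and l N C :: real
  assumes w: "\<And>n. w n \<ge> 0" and lN: "0 \<le> l" "l < N"
    and step: "\<And>n. ln (1 + w (Suc n)) \<le> ln (1 + w n) + \<alpha> n * q n + e n"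
    and e: "summable e"
    and \<alpha>: "\<And>n. 0 < \<alpha> n" "\<And>n. \<alpha> n \<le> a n"
    and a: "a \<longlonglongrightarrow> 0" "filterlim (\<lambda>n. \<Sum>k<n. a k) at_top sequentially"
    and C: "\<And>n. w n < l \<Longrightarrow> q n \<le> C"
    and q: "\<And>n. w n \<ge> l \<Longrightarrow> q n \<le> 0"
    and unif: "\<And>R. \<exists>\<delta>>0. \<forall>n. l \<le> w n \<longrightarrow> w n \<le> R \<longrightarrow> \<alpha> n * q n \<le> - \<delta> * a n"
  shows "eventually (\<lambda>n. w n < N) sequentially"
proof -
  define V where "V n = ln (1 + w n)" for n
  define S where "S n = (\<Sum>k<n. e k)" for n
  define \<mu> where "\<mu> = ln (1 + l)"
  \<comment> \<open>One third of the logarithmic gap is for the step leaving the region below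
    \<open>l\<close>, one for the noise afterwards, and one is spare.\<close>
  define \<epsilon> where "\<epsilon> = (ln (1 + N) - \<mu>) / 3"
  have \<epsilon>: "\<epsilon> > 0" using lN by (simp add: \<epsilon>_def \<mu>_def)
  have step': "V (Suc n) \<le> V n + \<alpha> n * q n + (S (Suc n) - S n)" for n
    using step[of n] by (simp add: V_def S_def)
  have "Cauchy S"
    using e by (auto simp: summable_iff_convergent S_def[abs_def] convergent_Cauchy)
  then obtain n1 where n1: "\<And>i j. i \<ge> n1 \<Longrightarrow> j \<ge> n1 \<Longrightarrow> \<bar>S i - S j\<bar> < \<epsilon>"
    using \<epsilon> unfolding Cauchy_def dist_real_def by metis
  have "(\<lambda>n. \<bar>C\<bar> * a n) \<longlonglongrightarrow> 0" using tendsto_mult_right_zero[OF a(1)] by simp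
  then have "eventually (\<lambda>n. \<bar>C\<bar> * a n < \<epsilon>) sequentially"
    using \<epsilon> by (rule order_tendstoD)
  then obtain n2 where n2: "\<And>n. n \<ge> n2 \<Longrightarrow> \<bar>C\<bar> * a n < \<epsilon>"
    by (auto simp: eventually_sequentially)
  define n0 where "n0 = max n1 n2"
  have nonincr: "V (Suc k) \<le> V k + (S (Suc k) - S k)" if "w k \<ge> l" for k
    using step'[of k] mult_nonneg_nonpos[OF less_imp_le[OF \<alpha>(1)[of k]] q[OF that]] by linarith
  have "\<exists>j\<ge>n0. w j < l"
  proof (rule ccontr)
    assume "\<not> ?thesis"
    then have ge: "\<And>j. j \<ge> n0 \<Longrightarrow> w j \<ge> l" by force
    have V_le: "V k \<le> V n0 + (S k - S n0)" if "k \<ge> n0" for k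
      using that
    proof (induction k rule: dec_induct)
      case (step k)
      then show ?case using nonincr[of k] ge[of k] by linarith
    qed simp
    \<comment> \<open>While the path stays above \<open>l\<close>, V grows by at most the noise
      oscillation. This caps \<open>w\<close> and so makes \<open>unif\<close> available, which
      turns the possibly tiny \<open>\<alpha> n\<close> into a fixed multiple of
      \<open>a n\<close>.\<close>
    define R where "R = exp (V n0 + \<epsilon>)"
    have wR: "w k \<le> R" if "k \<ge> n0" for k
    proof -
      have "V k \<le> V n0 + \<epsilon>" using V_le[OF that] n1[of k n0] that by (auto simp: n0_def)
      then have "exp (V k) \<le> R" by (simp add: R_def)
      then show ?thesis using w[of k] by (simp add: V_def)
    qed
    obtain \<delta> where \<delta>: "\<delta> > 0" "\<And>n. l \<le> w n \<Longrightarrow> w n \<le> R \<Longrightarrow> \<alpha> n * q n \<le> - \<delta> * a n"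
      using unif[of R] by blast
    define A where "A n = (\<Sum>k<n. a k)" for n
    have V_le2: "V k \<le> V n0 + (S k - S n0) - \<delta> * (A k - A n0)" if "k \<ge> n0" for k
      using that
    proof (induction k rule: dec_induct)
      case (step k)
      have "\<alpha> k * q k \<le> - \<delta> * a k" using step(1) by (intro \<delta>(2) ge wR)
      then show ?case using step'[of k] step.IH by (simp add: A_def algebra_simps)
    qed simp
    \<comment> \<open>The threshold is where the accumulated drift exhausts V at \<open>n0\<close>
      together with the noise allowance, forcing V below 0.\<close>
    have "eventually (\<lambda>n. A n > A n0 + (V n0 + \<epsilon>) / \<delta>) sequentially"
      using a(2) by (simp add: A_def filterlim_at_top_dense)
    then have "eventually (\<lambda>n. A n > A n0 + (V n0 + \<epsilon>) / \<delta> \<and> n \<ge> n0) sequentially"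
      using eventually_ge_at_top by (rule eventually_conj)
    then obtain k where k: "A k > A n0 + (V n0 + \<epsilon>) / \<delta>" "k \<ge> n0"
      using eventually_sequentially by force
    then have "\<delta> * (A k - A n0) > V n0 + \<epsilon>" using \<delta>(1) by (simp add: field_simps)
    moreover have "S k - S n0 < \<epsilon>" using n1[of k n0] k(2) by (auto simp: n0_def)
    ultimately have "V k < 0" using V_le2[OF k(2)] by linarith
    then show False using w[of k] by (simp add: V_def)
  qed
  then obtain j where j: "j \<ge> n0" "w j < l" by blast
  have inv: "\<exists>p\<ge>n0. V k \<le> \<mu> + \<epsilon> + (S k - S p)" if "j \<le> k" for k
    using that
  proof (induction k rule: dec_induct)
    case base
    have "V j \<le> \<mu>" using j w[of j] by (simp add: V_def \<mu>_def)
    then show ?case using j \<epsilon> by (intro exI[of _ j]) auto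
  next
    case (step k)
    show ?case
    proof (cases "w k < l")
      case True
      \<comment> \<open>Below \<open>l\<close> the drift may point upwards; here only its bound
        \<open>C\<close> and the smallness of \<open>a k\<close> help, and the noise count restarts
        at \<open>k\<close>.\<close>
      have "\<alpha> k * q k \<le> \<alpha> k * \<bar>C\<bar>" using \<alpha>(1)[of k] C[OF True] by (intro mult_left_mono) auto
      also have "\<dots> \<le> a k * \<bar>C\<bar>" using \<alpha>(2) by (intro mult_right_mono) auto
      also have "\<dots> < \<epsilon>" using n2[of k] step(1) j by (simp add: n0_def mult.commute)
      finally have "\<alpha> k * q k < \<epsilon>" .
      moreover have "V k \<le> \<mu>" using True w[of k] by (simp add: V_def \<mu>_def)
      ultimately show ?thesis using step'[of k] step(1) j by (intro exI[of _ k]) auto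
    next
      case False
      then have "V (Suc k) \<le> V k + (S (Suc k) - S k)" by (intro nonincr) simp
      moreover obtain p where "p \<ge> n0" "V k \<le> \<mu> + \<epsilon> + (S k - S p)" using step.IH by blast
      ultimately show ?thesis by (intro exI[of _ p]) auto
    qed
  qed
  have "w k < N" if kj: "j \<le> k" for k
  proof -
    obtain p where p: "p \<ge> n0" "V k \<le> \<mu> + \<epsilon> + (S k - S p)" using inv[OF kj] by blast
    have "S k - S p < \<epsilon>" using n1[of k p] p(1) kj j(1) by (simp add: n0_def)
    moreover have "ln (1 + N) = \<mu> + 3 * \<epsilon>" by (simp add: \<epsilon>_def field_simps)
    ultimately have "V k < ln (1 + N)" using p \<epsilon> by linarith
    then show ?thesis using w[of k] lN by (simp add: V_def)
  qed
  then show ?thesis by (auto simp: eventually_sequentially)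
qed


section \<open>Martingale differences and conditional expectations\<close>

text \<open>T below is the partial-sum process stopped when it first leaves the interval (-c, c). Its
  cross terms vanish because the multiplier Y is bounded by c.\<close>

lemma (in prob_space) martingale_maximal_inequality:
  fixes D :: "nat \<Rightarrow> 'a \<Rightarrow> real"
  assumes F: "\<And>n. subalgebra M (F n)" "\<And>n. subalgebra (F (Suc n)) (F n)"
    and D: "\<And>n. D n \<in> borel_measurable (F (Suc n))"
    and D2: "\<And>n. integrable M (\<lambda>x. (D n x)\<^sup>2)"
    and orth: "\<And>n Y c. Y \<in> borel_measurable (F n) \<Longrightarrow> (\<And>x. \<bar>Y x\<bar> \<le> c) \<Longrightarrow>
      (\<integral>x. Y x * D n x \<partial>M) = 0"
    and c: "c > 0"
  shows "measure M {x \<in> space M. \<exists>k\<le>n. c \<le> \<bar>\<Sum>j<k. D j x\<bar>} \<le> (\<Sum>j<n. \<integral>x. (D j x)\<^sup>2 \<partial>M) / c\<^sup>2"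
proof -
  define S where "S k x = (\<Sum>j<k. D j x)" for k x
  define A where "A k x \<longleftrightarrow> (\<forall>j\<le>k. \<bar>S j x\<bar> < c)" for k x
  \<comment> \<open>\<open>A j\<close> is known at time \<open>j\<close>, whereas \<open>D j\<close>
    is revealed at \<open>Suc j\<close>. The increment that leaves the interval is therefore still
    counted, and \<open>T\<close> freezes at a value of size at least \<open>c\<close>.\<close>
  define T where "T k x = (\<Sum>j<k. if A j x then D j x else 0)" for k x
  have Fmono: "subalgebra (F k) (F j)" if "j \<le> k" for j k
    using that
  proof (induction k rule: dec_induct)
    case (step k)
    then show ?case using F(2)[of k] by (auto simp: subalgebra_def)
  qed (simp add: subalgebra_def)
  have S_meas: "S j \<in> borel_measurable (F k)" if "j \<le> k" for j k
    unfolding S_def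
  proof (rule borel_measurable_sum)
    fix i assume "i \<in> {..<j}"
    then have "Suc i \<le> k" using that by auto
    then show "D i \<in> borel_measurable (F k)" using measurable_from_subalg[OF Fmono D] by blast
  qed
  have A_meas: "Measurable.pred (F k) (A k)" for k
  proof -
    have "Measurable.pred (F k) (\<lambda>x. \<forall>j\<in>{..k}. \<bar>S j x\<bar> < c)"
    proof (rule pred_intros_finite(3))
      fix j assume "j \<in> {..k}"
      then have [measurable]: "S j \<in> borel_measurable (F k)" using S_meas by auto
      show "Measurable.pred (F k) (\<lambda>x. \<bar>S j x\<bar> < c)" by measurable
    qed simp
    moreover have "A k = (\<lambda>x. \<forall>j\<in>{..k}. \<bar>S j x\<bar> < c)" by (auto simp: A_def fun_eq_iff)
    ultimately show ?thesis by (simp only:)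
  qed
  have T_eq_S: "T k x = S k x" if "\<And>j. j < k \<Longrightarrow> A j x" for k x
    unfolding T_def S_def by (intro sum.cong) (use that in auto)
  have DM [measurable]: "D k \<in> borel_measurable M" for k
    using measurable_from_subalg[OF F(1) D] .
  have AM [measurable]: "Measurable.pred M (A k)" for k
    using measurable_from_subalg[OF F(1) A_meas] .
  have TM [measurable]: "T k \<in> borel_measurable M" for k unfolding T_def by measurable
  have D1: "integrable M (D k)" for k by (rule square_integrable_imp_integrable[OF DM D2])
  have T2: "integrable M (\<lambda>x. (T k x)\<^sup>2) \<and>
      (\<integral>x. (T k x)\<^sup>2 \<partial>M) \<le> (\<Sum>j<k. \<integral>x. (D j x)\<^sup>2 \<partial>M)" for k
  proof (induction k)
    case (Suc k)
    \<comment> \<open>After that last increment \<open>T k\<close> may overshoot \<open>c\<close>,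
      so it cannot itself be a test function in \<open>orth\<close>. On \<open>A k\<close> it equals
      \<open>S k\<close>, which is bounded by \<open>c\<close>; off \<open>A k\<close> there is no
      increment to multiply.\<close>
    define Y where "Y x = (if A k x then S k x else 0)" for x
    define E where "E x = (if A k x then (D k x)\<^sup>2 else 0)" for x
    have Y_meas: "Y \<in> borel_measurable (F k)"
      unfolding Y_def using A_meas[of k] S_meas[of k k] by (intro measurable_If) (auto simp: pred_def)
    have Y_le: "\<bar>Y x\<bar> \<le> c" for x using c by (auto simp: Y_def A_def)
    have [measurable]: "Y \<in> borel_measurable M" using measurable_from_subalg[OF F(1) Y_meas] .
    have YD: "integrable M (\<lambda>x. Y x * D k x)"
    proof (rule Bochner_Integration.integrable_bound[of _ "\<lambda>x. c * D k x"])
      show "AE x in M. norm (Y x * D k x) \<le> norm (c * D k x)"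
        using Y_le c by (auto simp: abs_mult intro!: mult_right_mono)
    qed (use D1 in auto)
    have E: "integrable M E"
    proof (rule Bochner_Integration.integrable_bound[OF D2[of k]])
      show "E \<in> borel_measurable M" unfolding E_def by measurable
    qed (simp add: E_def)
    have TS: "T k x = S k x" if "A k x" for x
      using that by (intro T_eq_S) (auto simp: A_def)
    have eq: "(T (Suc k) x)\<^sup>2 = (T k x)\<^sup>2 + 2 * (Y x * D k x) + E x" for x
    proof -
      have "T (Suc k) x = T k x + (if A k x then D k x else 0)" by (simp add: T_def)
      then show ?thesis using TS[of x] by (simp add: Y_def E_def power2_eq_square algebra_simps)
    qed
    have "(\<integral>x. (T (Suc k) x)\<^sup>2 \<partial>M) = (\<integral>x. (T k x)\<^sup>2 \<partial>M) + 2 * (\<integral>x. Y x * D k x \<partial>M) + (\<integral>x. E x \<partial>M)"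
      unfolding eq using Suc YD E by simp
    also have "(\<integral>x. Y x * D k x \<partial>M) = 0" by (rule orth[OF Y_meas Y_le])
    also have "(\<integral>x. E x \<partial>M) \<le> (\<integral>x. (D k x)\<^sup>2 \<partial>M)"
      by (rule integral_mono[OF E D2]) (simp add: E_def)
    finally show ?case unfolding eq using Suc YD E by simp
  qed (simp add: T_def)
  have "\<bar>T n x\<bar> \<ge> c" if "\<exists>k\<le>n. c \<le> \<bar>S k x\<bar>" for x
  proof -
    obtain k0 where k0: "k0 \<le> n" "c \<le> \<bar>S k0 x\<bar>" using \<open>\<exists>k\<le>n. c \<le> \<bar>S k x\<bar>\<close> by blast
    define k where "k = (LEAST k. c \<le> \<bar>S k x\<bar>)"
    have k: "c \<le> \<bar>S k x\<bar>" unfolding k_def by (rule LeastI[of _ k0]) (rule k0)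
    have kn: "k \<le> n" unfolding k_def by (rule order_trans[OF Least_le]) (use k0 in auto)
    have less: "\<bar>S j x\<bar> < c" if "j < k" for j
      using not_less_Least[of j "\<lambda>k. c \<le> \<bar>S k x\<bar>"] that by (auto simp: k_def)
    have "T n x = T k x"
      unfolding T_def by (rule sum.mono_neutral_right) (use kn k in \<open>auto simp: A_def not_less\<close>)
    also have "\<dots> = S k x" by (rule T_eq_S) (auto simp: A_def intro: less)
    finally show ?thesis using k by simp
  qed
  then have "measure M {x \<in> space M. \<exists>k\<le>n. c \<le> \<bar>S k x\<bar>} \<le> measure M {x \<in> space M. \<bar>T n x\<bar> \<ge> c}"
    by (intro finite_measure_mono) auto
  also have "\<dots> \<le> (\<integral>x. (T n x)\<^sup>2 \<partial>M) / c\<^sup>2"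
    using T2 c by (intro second_moment_method) auto
  also have "\<dots> \<le> (\<Sum>j<n. \<integral>x. (D j x)\<^sup>2 \<partial>M) / c\<^sup>2"
    using T2 by (intro divide_right_mono) auto
  finally show ?thesis by (simp add: S_def)
qed

text \<open>The maximal inequality, applied to the sums restarted at time \<open>n\<close>, controls
  the oscillation of the tail by the remaining variance, so the partial sums are almost surely
  Cauchy.\<close>

lemma (in prob_space) AE_summable_martingale_differences:
  fixes D :: "nat \<Rightarrow> 'a \<Rightarrow> real"
  assumes F: "\<And>n. subalgebra M (F n)" "\<And>n. subalgebra (F (Suc n)) (F n)"
    and D: "\<And>n. D n \<in> borel_measurable (F (Suc n))"
    and D2: "\<And>n. integrable M (\<lambda>x. (D n x)\<^sup>2)"
    and orth: "\<And>n Y c. Y \<in> borel_measurable (F n) \<Longrightarrow> (\<And>x. \<bar>Y x\<bar> \<le> c) \<Longrightarrow>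
      (\<integral>x. Y x * D n x \<partial>M) = 0"
    and sum: "summable (\<lambda>n. \<integral>x. (D n x)\<^sup>2 \<partial>M)"
  shows "AE x in M. summable (\<lambda>n. D n x)"
proof -
  have [measurable]: "D k \<in> borel_measurable M" for k
    using measurable_from_subalg[OF F(1) D] .
  define v where "v n = (\<integral>x. (D n x)\<^sup>2 \<partial>M)" for n
  have v0: "v n \<ge> 0" for n by (simp add: v_def)
  have sv: "summable (\<lambda>j. v (n + j))" for n
    using summable_ignore_initial_segment[of v n] sum by (simp add: v_def[abs_def] add.commute)
  have tail: "measure M {x \<in> space M. \<exists>k. c \<le> \<bar>\<Sum>j<k. D (n + j) x\<bar>} \<le> (\<Sum>j. v (n + j)) / c\<^sup>2"
    if c: "c > 0" for n c
  proof -
    let ?B = "\<lambda>i. {x \<in> space M. \<exists>k\<le>i. c \<le> \<bar>\<Sum>j<k. D (n + j) x\<bar>}"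
    \<comment> \<open>Continuity from below carries the finite-horizon bound, uniform in
      \<open>i\<close>, over to an unbounded horizon.\<close>
    have "(\<lambda>i. measure M (?B i)) \<longlonglongrightarrow> measure M (\<Union>i. ?B i)"
      by (rule finite_Lim_measure_incseq) (auto simp: incseq_def intro: order_trans)
    moreover have "measure M (?B i) \<le> (\<Sum>j. v (n + j)) / c\<^sup>2" for i
    proof -
      have "measure M (?B i) \<le> (\<Sum>j<i. \<integral>x. (D (n + j) x)\<^sup>2 \<partial>M) / c\<^sup>2"
        by (rule martingale_maximal_inequality[where F = "\<lambda>j. F (n + j)"])
          (use F D D2 c in \<open>auto intro: orth\<close>)
      also have "\<dots> \<le> (\<Sum>j. v (n + j)) / c\<^sup>2"
        using sum_le_suminf[OF sv, of "{..<i}"] v0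
        by (intro divide_right_mono) (auto simp: v_def)
      finally show ?thesis .
    qed
    ultimately have "measure M (\<Union>i. ?B i) \<le> (\<Sum>j. v (n + j)) / c\<^sup>2"
      by (intro LIMSEQ_le_const2) auto
    moreover have "(\<Union>i. ?B i) = {x \<in> space M. \<exists>k. c \<le> \<bar>\<Sum>j<k. D (n + j) x\<bar>}" by auto
    ultimately show ?thesis by simp
  qed
  have "AE x in M. \<exists>n. \<forall>k. \<bar>\<Sum>j<k. D (n + j) x\<bar> < c" if c: "c > 0" for c
  proof -
    let ?B = "{x \<in> space M. \<forall>n. \<exists>k. c \<le> \<bar>\<Sum>j<k. D (n + j) x\<bar>}"
    \<comment> \<open>The event that every tail oscillates by at least \<open>c\<close> lies in each
      single tail event, and the bounds for these tend to 0.\<close>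
    have "measure M ?B \<le> (\<Sum>j. v (n + j)) / c\<^sup>2" for n
      by (rule order_trans[OF finite_measure_mono tail[OF c, of n]]) auto
    moreover have "(\<lambda>n. (\<Sum>j. v (n + j)) / c\<^sup>2) \<longlonglongrightarrow> 0"
      using tendsto_divide[OF suminf_exist_split2[of v] tendsto_const[of "c\<^sup>2"]] sum c
      by (simp add: v_def[abs_def] add.commute)
    ultimately have "measure M ?B \<le> 0" by (intro LIMSEQ_le_const) auto
    then have "emeasure M ?B = 0" by (simp add: emeasure_eq_measure measure_le_0_iff)
    then show ?thesis
      by (intro AE_I[of _ _ ?B]) (auto simp: not_less)
  qed
  \<comment> \<open>The null set depends on \<open>c\<close>, so only countably many values of
    \<open>c\<close> may be combined.\<close>
  then have "AE x in M. \<forall>i. \<exists>n. \<forall>k. \<bar>\<Sum>j<k. D (n + j) x\<bar> < 1 / Suc i"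
    by (subst AE_all_countable) auto
  then show ?thesis
  proof eventually_elim
    case (elim x)
    define S where "S k = (\<Sum>j<k. D j x)" for k
    have S_add: "S (n + k) = S n + (\<Sum>j<k. D (n + j) x)" for n k
      by (induction k) (simp_all add: S_def)
    have "Cauchy S"
    proof (rule metric_CauchyI)
      fix e :: real assume "e > 0"
      then obtain i where i: "1 / Suc i < e / 2"
        using reals_Archimedean[of "e / 2"] by (auto simp: inverse_eq_divide)
      obtain n where n: "\<And>k. \<bar>\<Sum>j<k. D (n + j) x\<bar> < 1 / Suc i" using elim by blast
      have close: "\<bar>S k - S n\<bar> < e / 2" if "k \<ge> n" for k
        using n[of "k - n"] S_add[of n "k - n"] that i by simp
      have "dist (S p) (S q) < e" if "p \<ge> n" "q \<ge> n" for p q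
        using close[OF that(1)] close[OF that(2)] unfolding dist_real_def by linarith
      then show "\<exists>n. \<forall>p\<ge>n. \<forall>q\<ge>n. dist (S p) (S q) < e" by blast
    qed
    then show ?case
      by (simp add: summable_iff_convergent S_def[abs_def] Cauchy_convergent)
  qed
qed

text \<open>Sum and integral commute for nonnegative terms, so the sum has finite integral and is
  finite almost everywhere.\<close>

lemma AE_summable_of_summable_integrals:
  fixes R :: "nat \<Rightarrow> 'a \<Rightarrow> real"
  assumes R: "\<And>n. integrable M (R n)" "\<And>n x. R n x \<ge> 0"
    and r: "\<And>n. (\<integral>x. R n x \<partial>M) \<le> r n" "summable r"
  shows "AE x in M. summable (\<lambda>n. R n x)"
proof -
  have [measurable]: "R n \<in> borel_measurable M" for n using R(1) by auto
  have "summable (\<lambda>n. \<integral>x. R n x \<partial>M)"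
    by (rule summable_comparison_test[OF _ r(2)]) (use r(1) R(2) in \<open>auto simp: integral_nonneg_AE\<close>)
  then have "(\<Sum>n. ennreal (\<integral>x. R n x \<partial>M)) \<noteq> \<infinity>"
    using R(2) ennreal_suminf_neq_top by (simp add: integral_nonneg_AE)
  moreover have "(\<integral>\<^sup>+x. (\<Sum>n. ennreal (R n x)) \<partial>M) = (\<Sum>n. ennreal (\<integral>x. R n x \<partial>M))"
    using R by (simp add: nn_integral_suminf nn_integral_eq_integral)
  ultimately have "AE x in M. (\<Sum>n. ennreal (R n x)) \<noteq> \<infinity>"
    by (intro nn_integral_PInf_AE) auto
  then show ?thesis
    by eventually_elim (use R(2) summable_suminf_not_top in auto)
qed

text \<open>A bounded \<open>F\<close>-measurable factor can be pulled out of the conditional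
  expectation, one coordinate at a time. This converts the centering of the noise into the
  orthogonality demanded by the martingale lemmas.\<close>

lemma (in finite_measure_subalgebra) integral_inner_eq_0:
  fixes X Z :: "'a \<Rightarrow> 'b::euclidean_space"
  assumes X: "X \<in> borel_measurable F" "\<And>x. norm (X x) \<le> c"
    and Z: "integrable M Z" "AE x in M. vector_cond_exp M F Z x = 0"
  shows "(\<integral>x. X x \<bullet> Z x \<partial>M) = 0"
proof -
  have XM: "X \<in> borel_measurable M" by (rule measurable_from_subalg[OF subalg X(1)])
  have coord: "integrable M (\<lambda>x. (X x \<bullet> b) * (Z x \<bullet> b)) \<and> (\<integral>x. (X x \<bullet> b) * (Z x \<bullet> b) \<partial>M) = 0"
    if b: "b \<in> Basis" for b
  proof -
    have Zb: "integrable M (\<lambda>x. Z x \<bullet> b)" using Z(1) by simp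
    have int: "integrable M (\<lambda>x. (X x \<bullet> b) * (Z x \<bullet> b))"
    proof (rule Bochner_Integration.integrable_bound[of _ "\<lambda>x. c * (Z x \<bullet> b)"])
      have "\<bar>X x \<bullet> b\<bar> \<le> \<bar>c\<bar>" for x using Basis_le_norm[OF b, of "X x"] X(2)[of x] by linarith
      then show "AE x in M. norm ((X x \<bullet> b) * (Z x \<bullet> b)) \<le> norm (c * (Z x \<bullet> b))"
        by (auto simp: abs_mult intro!: mult_right_mono)
    qed (use XM Zb in auto)
    have "AE x in M. real_cond_exp M F (\<lambda>v. Z v \<bullet> b) x = 0"
      using Z(2)
    proof eventually_elim
      case (elim x)
      then have "vector_cond_exp M F Z x \<bullet> b = 0" by simp
      then show ?case using b by (simp add: vector_cond_exp_def)
    qed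
    then have "(\<integral>x. (X x \<bullet> b) * real_cond_exp M F (\<lambda>v. Z v \<bullet> b) x \<partial>M) = 0"
      by (intro integral_eq_zero_AE) auto
    then show ?thesis
      using real_cond_exp_intg(2)[OF int] X(1) Zb int by auto
  qed
  have "(\<integral>x. X x \<bullet> Z x \<partial>M) = (\<integral>x. (\<Sum>b\<in>Basis. (X x \<bullet> b) * (Z x \<bullet> b)) \<partial>M)"
    by (subst euclidean_inner) (rule refl)
  also have "\<dots> = 0" using coord by (subst Bochner_Integration.integral_sum) auto
  finally show ?thesis .
qed

text \<open>This is how moments of the iterates are avoided: \<open>r\<close> alone may fail to be
  integrable, and only the product \<open>X x * r x\<close> has to be bounded. The constant
  \<open>c\<close> secures integrability of the product with \<open>Q\<close> and does not enter the
  estimate.\<close>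

lemma integral_mult_le_of_cond_exp_le:
  fixes X Q :: "'a \<Rightarrow> real"
  assumes "prob_space M" and F: "subalgebra M F"
    and X: "X \<in> borel_measurable F" "\<And>x. X x \<ge> 0" "\<And>x. X x \<le> c"
    and Q: "integrable M Q" "AE x in M. real_cond_exp M F Q x \<le> r x"
    and C: "\<And>x. x \<in> space M \<Longrightarrow> X x * r x \<le> C"
  shows "integrable M (\<lambda>x. X x * Q x)" "(\<integral>x. X x * Q x \<partial>M) \<le> C"
proof -
  interpret prob_space M by fact
  interpret finite_measure_subalgebra M F by unfold_locales fact
  have [measurable]: "X \<in> borel_measurable M" by (rule measurable_from_subalg[OF subalg X(1)])
  show int: "integrable M (\<lambda>x. X x * Q x)"
  proof (rule Bochner_Integration.integrable_bound[of _ "\<lambda>x. c * Q x"])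
    have "\<bar>X x\<bar> \<le> \<bar>c\<bar>" for x using X(2,3)[of x] by linarith
    then show "AE x in M. norm (X x * Q x) \<le> norm (c * Q x)"
      by (auto simp: abs_mult intro!: mult_right_mono)
  qed (use Q in auto)
  have "(\<integral>x. X x * Q x \<partial>M) = (\<integral>x. X x * real_cond_exp M F Q x \<partial>M)"
    using real_cond_exp_intg(2)[OF int X(1)] Q by auto
  also have "\<dots> \<le> (\<integral>x. C \<partial>M)"
  proof (rule integral_mono_AE)
    show "integrable M (\<lambda>x. X x * real_cond_exp M F Q x)"
      using real_cond_exp_intg(1)[OF int X(1)] Q by auto
    show "AE x in M. X x * real_cond_exp M F Q x \<le> C"
      using Q(2) AE_space
    proof eventually_elim
      case (elim x)
      then show ?case using C[of x] mult_left_mono[OF elim(1) X(2)[of x]] by simp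
    qed
  qed auto
  also have "\<dots> = C" by (simp add: prob_space)
  finally show "(\<integral>x. X x * Q x \<partial>M) \<le> C" .
qed


section \<open>The adapted iterates\<close>

lemma noise_filtration_generators:
  "{y0 -` B \<inter> space P |B. B \<in> sets borel} \<union>
   {M k -` B \<inter> space P |k B. k \<in> {1..n} \<and> B \<in> sets borel} \<subseteq> Pow (space P)"
  by auto

lemma space_noise_filtration [simp]: "space (noise_filtration P y0 M n) = space P"
  unfolding noise_filtration_def by (rule space_measure_of[OF noise_filtration_generators])

lemma sets_noise_filtration:
  "sets (noise_filtration P y0 M n) = sigma_sets (space P)
     ({y0 -` B \<inter> space P |B. B \<in> sets borel} \<union>
      {M k -` B \<inter> space P |k B. k \<in> {1..n} \<and> B \<in> sets borel})"
  unfolding noise_filtration_def by (rule sets_measure_of[OF noise_filtration_generators])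

lemma subalgebra_noise_filtration:
  assumes "y0 \<in> borel_measurable P" "\<And>n. n \<ge> 1 \<Longrightarrow> M n \<in> borel_measurable P"
  shows "subalgebra P (noise_filtration P y0 M n)"
  unfolding subalgebra_def sets_noise_filtration
  by (intro conjI sets.sigma_sets_subset) (use assms in \<open>auto dest: measurable_sets\<close>)

lemma subalgebra_noise_filtration_Suc:
  "subalgebra (noise_filtration P y0 M (Suc n)) (noise_filtration P y0 M n)"
  unfolding subalgebra_def sets_noise_filtration
  by (intro conjI sigma_sets_mono' Un_mono) (simp_all, fastforce)

lemma measurable_noise_filtration:
  shows "y0 \<in> borel_measurable (noise_filtration P y0 M n)"
    and "1 \<le> k \<Longrightarrow> k \<le> n \<Longrightarrow> M k \<in> borel_measurable (noise_filtration P y0 M n)"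
  by (rule measurableI; simp add: sets_noise_filtration; rule sigma_sets.Basic; fastforce)+

section \<open>Step-size sequences\<close>

lemma summable_imp_tendsto_zero_of_squares:
  fixes a :: "nat \<Rightarrow> real"
  assumes "summable (\<lambda>n. (a n)\<^sup>2)"
  shows "a \<longlonglongrightarrow> 0"
  using summable_LIMSEQ_zero[OF assms] by (simp add: power_tendsto_0_iff)

lemma filterlim_partial_sums_cong:
  fixes u v :: "nat \<Rightarrow> real"
  assumes "finite {n. u n \<noteq> v n}" "filterlim (\<lambda>n. \<Sum>k<n. v k) at_top sequentially"
  shows "filterlim (\<lambda>n. \<Sum>k<n. u k) at_top sequentially"
proof -
  obtain n0 where n0: "\<And>n. n \<ge> n0 \<Longrightarrow> u n = v n"
    using assms(1) by (auto simp: finite_nat_set_iff_bounded not_less[symmetric])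
  have eq: "(\<Sum>k<n. u k) = (\<Sum>k<n0. u k - v k) + (\<Sum>k<n. v k)" if "n0 \<le> n" for n
    using that by (induction n rule: dec_induct) (auto simp: n0 sum_subtractf)
  have "filterlim (\<lambda>n. (\<Sum>k<n0. u k - v k) + (\<Sum>k<n. v k)) at_top sequentially"
    by (rule filterlim_tendsto_add_at_top[OF tendsto_const assms(2)])
  moreover have "eventually (\<lambda>n. (\<Sum>k<n. u k) = (\<Sum>k<n0. u k - v k) + (\<Sum>k<n. v k)) sequentially"
    using eq by (auto simp: eventually_sequentially)
  ultimately show ?thesis using filterlim_cong by fastforce
qed

text \<open>Hypothesis \<open>B\<close> condenses the growth control through \<open>g\<close>: drift
  and noise variance, divided by the square of \<open>g\<close>, grow at most like 1 + W. Dividing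
  the increment of \<open>W\<close> by 1 + W cancels exactly this growth.\<close>

lemma adapted_iterates_eventually_in_sublevel:
  fixes P :: "'w measure" and h :: "'a::euclidean_space \<Rightarrow> 'a" and W f g :: "'a \<Rightarrow> real"
    and a :: "nat \<Rightarrow> real" and M y :: "nat \<Rightarrow> 'w \<Rightarrow> 'a" and l N L B :: real
  assumes P: "prob_space P"
    and a: "\<And>n. a n > 0" "filterlim (\<lambda>n. \<Sum>k<n. a k) at_top sequentially"
      "summable (\<lambda>n. (a n)\<^sup>2)"
    and y0: "y 0 \<in> borel_measurable P"
    and M: "\<And>n. n \<ge> 1 \<Longrightarrow> M n \<in> borel_measurable P"
    and M_centered: "\<And>n. AE \<omega> in P.
      vector_cond_exp P (noise_filtration P (y 0) M n) (M (Suc n)) \<omega> = 0"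
    and M_sq: "\<And>n. n \<ge> 1 \<Longrightarrow> integrable P (\<lambda>\<omega>. (norm (M n \<omega>))\<^sup>2)"
    and M_bound: "\<And>n. AE \<omega> in P.
      real_cond_exp P (noise_filtration P (y 0) M n) (\<lambda>v. (norm (M (Suc n) v))\<^sup>2) \<omega> \<le> f (y n \<omega>)"
    and h: "continuous_on UNIV h"
    and f: "\<And>x. f x \<ge> 0"
    and W: "continuously_differentiable W" "continuous_on UNIV (grad W)" "\<And>x. W x \<ge> 0"
      "filterlim W at_top at_infinity"
    and L: "L > 0" "\<And>x y. norm (grad W x - grad W y) \<le> L * norm (x - y)"
    and lN: "0 \<le> l" "l < N"
    and drift: "\<And>x. W x \<ge> l \<Longrightarrow> h x \<bullet> grad W x < 0"
    and g: "g \<in> borel_measurable borel" "locally_bounded g" "\<And>x. g x \<ge> 1"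
    and B: "\<And>x. (norm (h x))\<^sup>2 + f x \<le> B * (1 + W x) * (g x)\<^sup>2"
    and y_Suc: "\<And>n \<omega>. \<omega> \<in> space P \<Longrightarrow>
      y (Suc n) \<omega> = y n \<omega> + (a n / g (y n \<omega>)) *\<^sub>R (h (y n \<omega>) + M (Suc n) \<omega>)"
  shows "AE \<omega> in P. eventually (\<lambda>n. W (y n \<omega>) < N) sequentially"
proof -
  interpret prob_space P by fact
  define F where "F = noise_filtration P (y 0) M"
  \<comment> \<open>\<open>G\<close> is the gradient of ln (1 + W).\<close>
  define G where "G x = (1 / (1 + W x)) *\<^sub>R grad W x" for x
  define \<alpha> where "\<alpha> n \<omega> = a n / g (y n \<omega>)" for n \<omega>
  define X where "X n \<omega> = \<alpha> n \<omega> *\<^sub>R G (y n \<omega>)" for n \<omega>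
  define D where "D n \<omega> = X n \<omega> \<bullet> M (Suc n) \<omega>" for n \<omega>
  \<comment> \<open>The factor \<open>L\<close> comes from the descent lemma, 2 from splitting the
    square of a sum, and the denominator from the tangent of the logarithm.\<close>
  define Z where "Z n \<omega> = 2 * L * (\<alpha> n \<omega>)\<^sup>2 / (1 + W (y n \<omega>))" for n \<omega>
  define R where "R n \<omega> = Z n \<omega> * (norm (M (Suc n) \<omega>))\<^sup>2" for n \<omega>
  \<comment> \<open>Adding 1 gives \<open>K \<le> K\<^sup>2\<close>, so a bound on the squared norm
    of \<open>G\<close> also bounds the norm.\<close>
  define K where "K = 4 * L + 1"
  have W_cont: "continuous_on UNIV W" by (rule continuously_differentiable_imp_continuous_on[OF W(1)])
  have W1: "1 + W x > 0" for x using W(3)[of x] by linarith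
  have G_cont: "continuous_on UNIV G"
    unfolding G_def by (intro continuous_intros W_cont W(2)) (use W1 in \<open>simp add: less_imp_neq[symmetric]\<close>)
  have meas [measurable]: "W \<in> borel_measurable borel" "G \<in> borel_measurable borel"
      "h \<in> borel_measurable borel" "g \<in> borel_measurable borel"
    using W_cont G_cont h g(1) by (auto intro: borel_measurable_continuous_onI)
  have F_sub: "subalgebra P (F n)" for n
    unfolding F_def using y0 M by (intro subalgebra_noise_filtration) auto
  have F_Suc: "subalgebra (F (Suc n)) (F n)" for n
    unfolding F_def by (rule subalgebra_noise_filtration_Suc)
  have M_F [measurable]: "M (Suc n) \<in> borel_measurable (F (Suc n))" for n
    unfolding F_def by (rule measurable_noise_filtration(2)) auto
  have y_F [measurable]: "y n \<in> borel_measurable (F n)" for n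
  proof (induction n)
    case 0
    then show ?case unfolding F_def by (rule measurable_noise_filtration(1))
  next
    case (Suc n)
    have [measurable]: "y n \<in> borel_measurable (F (Suc n))"
      by (rule measurable_from_subalg[OF F_Suc Suc])
    have "(\<lambda>\<omega>. y n \<omega> + (a n / g (y n \<omega>)) *\<^sub>R (h (y n \<omega>) + M (Suc n) \<omega>)) \<in> borel_measurable (F (Suc n))"
      by measurable
    then show ?case
      by (subst measurable_cong[OF y_Suc]) (simp_all add: F_def)
  qed
  have X_F [measurable]: "X n \<in> borel_measurable (F n)"
    and Z_F [measurable]: "Z n \<in> borel_measurable (F n)" for n
    unfolding X_def Z_def \<alpha>_def by measurable
  have D_F: "D n \<in> borel_measurable (F (Suc n))" for n
  proof -
    have [measurable]: "X n \<in> borel_measurable (F (Suc n))"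
      by (rule measurable_from_subalg[OF F_Suc X_F])
    show ?thesis unfolding D_def by measurable
  qed
  have \<alpha>: "0 < \<alpha> n \<omega>" "\<alpha> n \<omega> \<le> a n" for n \<omega>
    using a(1)[of n] g(3)[of "y n \<omega>"] by (auto simp: \<alpha>_def divide_le_eq)
  have \<alpha>_sq: "(\<alpha> n \<omega>)\<^sup>2 \<le> (a n)\<^sup>2" for n \<omega>
    using \<alpha>[of n \<omega>] by (intro power_mono) auto
  \<comment> \<open>The two denominators, \<open>g\<close> squared inside \<open>\<alpha>\<close>
    and 1 + W, cancel the whole right-hand side of \<open>B\<close>. What remains is deterministic
    and summable.\<close>
  have \<alpha>_B: "(\<alpha> n \<omega>)\<^sup>2 * ((norm (h (y n \<omega>)))\<^sup>2 + f (y n \<omega>)) / (1 + W (y n \<omega>)) \<le> B * (a n)\<^sup>2" for n \<omega>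
  proof -
    have "(\<alpha> n \<omega>)\<^sup>2 * ((norm (h (y n \<omega>)))\<^sup>2 + f (y n \<omega>)) / (1 + W (y n \<omega>))
        \<le> (\<alpha> n \<omega>)\<^sup>2 * (B * (1 + W (y n \<omega>)) * (g (y n \<omega>))\<^sup>2) / (1 + W (y n \<omega>))"
      using W1 by (intro divide_right_mono mult_left_mono B) (auto simp: less_imp_le)
    also have "\<dots> = B * (a n)\<^sup>2"
      using W1[of "y n \<omega>"] g(3)[of "y n \<omega>"] by (simp add: \<alpha>_def power_divide)
    finally show ?thesis .
  qed
  have G_sq: "(norm (G x))\<^sup>2 \<le> 4 * L / (1 + W x)" for x
  proof -
    have "(norm (G x))\<^sup>2 = (norm (grad W x))\<^sup>2 / (1 + W x)\<^sup>2"
      by (simp add: G_def power_divide)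
    also have "\<dots> \<le> (4 * L * W x) / (1 + W x)\<^sup>2"
      by (intro divide_right_mono norm_grad_squared_le[OF W(1,3) L]) auto
    also have "\<dots> \<le> (4 * L * (1 + W x)) / (1 + W x)\<^sup>2"
      using L(1) by (intro divide_right_mono) auto
    also have "\<dots> = 4 * L / (1 + W x)" using W1[of x] by (simp add: power2_eq_square)
    finally show ?thesis .
  qed
  have G_K: "norm (G x) \<le> K" for x
  proof -
    have "4 * L / (1 + W x) \<le> 4 * L" using L(1) W(3)[of x] by (simp add: divide_le_eq mult_left_mono)
    then have "(norm (G x))\<^sup>2 \<le> K" using G_sq[of x] by (simp add: K_def)
    also have "K \<le> K\<^sup>2" using L(1) by (intro self_le_power) (auto simp: K_def)
    finally show ?thesis by (rule power2_le_imp_le) (use L(1) in \<open>simp add: K_def\<close>)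
  qed
  have X_K: "norm (X n \<omega>) \<le> a n * K" for n \<omega>
    using \<alpha>[of n \<omega>] G_K[of "y n \<omega>"] by (auto simp: X_def intro!: mult_mono)
  have M1: "integrable P (M (Suc n))" for n
  proof -
    have [measurable]: "M (Suc n) \<in> borel_measurable P" by (rule M) simp
    have "integrable P (\<lambda>\<omega>. norm (M (Suc n) \<omega>))"
      by (rule square_integrable_imp_integrable) (use M_sq in auto)
    then show ?thesis by (simp add: integrable_norm_iff)
  qed
  have DP [measurable]: "D n \<in> borel_measurable P" for n by (rule measurable_from_subalg[OF F_sub D_F])
  have X2: "integrable P (\<lambda>\<omega>. (norm (X n \<omega>))\<^sup>2 * (norm (M (Suc n) \<omega>))\<^sup>2)"
      "(\<integral>\<omega>. (norm (X n \<omega>))\<^sup>2 * (norm (M (Suc n) \<omega>))\<^sup>2 \<partial>P) \<le> 4 * L * B * (a n)\<^sup>2" for n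
  proof -
    \<comment> \<open>\<open>G_sq\<close> supplies the factor 1 / (1 + W) that
      \<open>\<alpha>_B\<close> needs; the plain bound \<open>G_K\<close> would leave the growth of
      \<open>f\<close> uncontrolled.\<close>
    have le: "(norm (X n \<omega>))\<^sup>2 * f (y n \<omega>) \<le> 4 * L * B * (a n)\<^sup>2" for \<omega>
    proof -
      have "(norm (X n \<omega>))\<^sup>2 * f (y n \<omega>) = (norm (G (y n \<omega>)))\<^sup>2 * ((\<alpha> n \<omega>)\<^sup>2 * f (y n \<omega>))"
        by (simp add: X_def power_mult_distrib)
      also have "\<dots> \<le> (4 * L / (1 + W (y n \<omega>))) * ((\<alpha> n \<omega>)\<^sup>2 * ((norm (h (y n \<omega>)))\<^sup>2 + f (y n \<omega>)))"
        using L(1) W1[of "y n \<omega>"] f by (intro mult_mono G_sq) (auto simp: mult_left_mono)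
      also have "\<dots> = 4 * L * ((\<alpha> n \<omega>)\<^sup>2 * ((norm (h (y n \<omega>)))\<^sup>2 + f (y n \<omega>)) / (1 + W (y n \<omega>)))"
        by simp
      also have "\<dots> \<le> 4 * L * (B * (a n)\<^sup>2)" using L(1) by (intro mult_left_mono \<alpha>_B) auto
      finally show ?thesis by simp
    qed
    have bd: "(norm (X n \<omega>))\<^sup>2 \<le> (a n * K)\<^sup>2" for \<omega>
      by (rule power_mono[OF X_K]) simp
    have "(\<lambda>\<omega>. (norm (X n \<omega>))\<^sup>2) \<in> borel_measurable (F n)" by measurable
    from integral_mult_le_of_cond_exp_le[OF P F_sub this _ bd M_sq M_bound[folded F_def] le]
    show "integrable P (\<lambda>\<omega>. (norm (X n \<omega>))\<^sup>2 * (norm (M (Suc n) \<omega>))\<^sup>2)"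
      "(\<integral>\<omega>. (norm (X n \<omega>))\<^sup>2 * (norm (M (Suc n) \<omega>))\<^sup>2 \<partial>P) \<le> 4 * L * B * (a n)\<^sup>2"
      by auto
  qed
  have D_le: "(D n \<omega>)\<^sup>2 \<le> (norm (X n \<omega>))\<^sup>2 * (norm (M (Suc n) \<omega>))\<^sup>2" for n \<omega>
    using power_mono[OF Cauchy_Schwarz_ineq2[of "X n \<omega>" "M (Suc n) \<omega>"], of 2]
    by (simp add: D_def power_mult_distrib)
  have D2: "integrable P (\<lambda>\<omega>. (D n \<omega>)\<^sup>2)" for n
    by (rule Bochner_Integration.integrable_bound[OF X2(1)[of n]]) (use D_le in auto)
  have D2_le: "(\<integral>\<omega>. (D n \<omega>)\<^sup>2 \<partial>P) \<le> 4 * L * B * (a n)\<^sup>2" for n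
    by (rule order_trans[OF integral_mono[OF D2 X2(1)] X2(2)]) (rule D_le)
  have AE_D: "AE \<omega> in P. summable (\<lambda>n. D n \<omega>)"
  proof (rule AE_summable_martingale_differences[where F = F, OF F_sub F_Suc D_F D2])
    fix n Y c assume Y [measurable]: "Y \<in> borel_measurable (F n)" and Yc: "\<And>\<omega>. \<bar>Y \<omega>\<bar> \<le> (c::real)"
    interpret F: finite_measure_subalgebra P "F n" by unfold_locales (rule F_sub)
    have c: "c \<ge> 0" using Yc[of undefined] by linarith
    \<comment> \<open>The scalar test function is absorbed into the vector multiplier, which stays
      bounded and \<open>F n\<close>-measurable.\<close>
    have "(\<integral>\<omega>. (Y \<omega> *\<^sub>R X n \<omega>) \<bullet> M (Suc n) \<omega> \<partial>P) = 0"
    proof (rule F.integral_inner_eq_0)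
      show "norm (Y \<omega> *\<^sub>R X n \<omega>) \<le> c * (a n * K)" for \<omega>
        using Yc[of \<omega>] X_K[of n \<omega>] c by (auto intro!: mult_mono)
    qed (use M1 M_centered in \<open>auto simp: F_def[symmetric]\<close>)
    then show "(\<integral>\<omega>. Y \<omega> * D n \<omega> \<partial>P) = 0" by (simp add: D_def)
  next
    show "summable (\<lambda>n. \<integral>\<omega>. (D n \<omega>)\<^sup>2 \<partial>P)"
      by (rule summable_comparison_test[OF _ summable_mult[OF a(3), of "4 * L * B"]]) (use D2_le in auto)
  qed
  have Z0: "0 \<le> Z n \<omega>" for n \<omega> using L(1) W1[of "y n \<omega>"] by (simp add: Z_def)
  have R_int: "integrable P (R n)" "(\<integral>\<omega>. R n \<omega> \<partial>P) \<le> 2 * L * B * (a n)\<^sup>2" for n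
  proof -
    have le: "Z n \<omega> * f (y n \<omega>) \<le> 2 * L * B * (a n)\<^sup>2" for \<omega>
    proof -
      have "Z n \<omega> * f (y n \<omega>) \<le> Z n \<omega> * ((norm (h (y n \<omega>)))\<^sup>2 + f (y n \<omega>))"
        using Z0 by (intro mult_left_mono) auto
      also have "\<dots> = 2 * L * ((\<alpha> n \<omega>)\<^sup>2 * ((norm (h (y n \<omega>)))\<^sup>2 + f (y n \<omega>)) / (1 + W (y n \<omega>)))"
        by (simp add: Z_def)
      also have "\<dots> \<le> 2 * L * (B * (a n)\<^sup>2)" using L(1) by (intro mult_left_mono \<alpha>_B) auto
      finally show ?thesis by simp
    qed
    have bd: "Z n \<omega> \<le> 2 * L * (a n)\<^sup>2" for \<omega>
    proof -
      have "Z n \<omega> \<le> 2 * L * (\<alpha> n \<omega>)\<^sup>2"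
        using L(1) W(3)[of "y n \<omega>"] W1[of "y n \<omega>"] mult_left_mono[of 1 "1 + W (y n \<omega>)" "2 * L * (\<alpha> n \<omega>)\<^sup>2"]
        by (simp add: Z_def pos_divide_le_eq)
      also have "\<dots> \<le> 2 * L * (a n)\<^sup>2" using L(1) \<alpha>_sq by (intro mult_left_mono) auto
      finally show ?thesis .
    qed
    from integral_mult_le_of_cond_exp_le[OF P F_sub Z_F Z0 bd M_sq M_bound[folded F_def] le]
    show "integrable P (R n)" "(\<integral>\<omega>. R n \<omega> \<partial>P) \<le> 2 * L * B * (a n)\<^sup>2"
      by (auto simp: R_def[abs_def])
  qed
  have AE_R: "AE \<omega> in P. summable (\<lambda>n. R n \<omega>)"
    by (rule AE_summable_of_summable_integrals[OF R_int(1) _ R_int(2) summable_mult[OF a(3)]])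
      (use Z0 in \<open>simp add: R_def\<close>)
  \<comment> \<open>The bracket is the perturbation: the deterministic term pays for the squared
    drift, \<open>R\<close> for the squared noise, and \<open>D\<close> is the part linear in the
    noise.\<close>
  have step: "ln (1 + W (y (Suc n) \<omega>)) \<le> ln (1 + W (y n \<omega>)) + \<alpha> n \<omega> * (G (y n \<omega>) \<bullet> h (y n \<omega>))
      + (2 * L * B * (a n)\<^sup>2 + R n \<omega> + D n \<omega>)" if \<omega>: "\<omega> \<in> space P" for n \<omega>
  proof -
    define x where "x = y n \<omega>"
    define v where "v = h x + M (Suc n) \<omega>"
    have y': "y (Suc n) \<omega> = x + \<alpha> n \<omega> *\<^sub>R v" using y_Suc[OF \<omega>] by (simp add: x_def v_def \<alpha>_def)
    have v2: "(norm v)\<^sup>2 \<le> 2 * (norm (h x))\<^sup>2 + 2 * (norm (M (Suc n) \<omega>))\<^sup>2"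
    proof -
      have "(norm v)\<^sup>2 \<le> (norm (h x) + norm (M (Suc n) \<omega>))\<^sup>2"
        unfolding v_def by (intro power_mono norm_triangle_ineq) simp
      also have "\<dots> \<le> 2 * (norm (h x))\<^sup>2 + 2 * (norm (M (Suc n) \<omega>))\<^sup>2"
        using sum_squares_bound[of "norm (h x)" "norm (M (Suc n) \<omega>)"]
        by (simp add: power2_sum)
      finally show ?thesis .
    qed
    have "W (y (Suc n) \<omega>) \<le> W x + grad W x \<bullet> (\<alpha> n \<omega> *\<^sub>R v) + L * (norm (\<alpha> n \<omega> *\<^sub>R v))\<^sup>2"
      unfolding y' by (rule descent_lemma[OF W(1) L(2)])
    also have "\<dots> = W x + \<alpha> n \<omega> * (grad W x \<bullet> v) + L * (\<alpha> n \<omega>)\<^sup>2 * (norm v)\<^sup>2"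
      by (simp add: power_mult_distrib)
    also have "\<dots> \<le> W x + \<alpha> n \<omega> * (grad W x \<bullet> v)
        + L * (\<alpha> n \<omega>)\<^sup>2 * (2 * (norm (h x))\<^sup>2 + 2 * (norm (M (Suc n) \<omega>))\<^sup>2)"
      using L(1) v2 by (intro add_left_mono mult_left_mono) auto
    finally have "(W (y (Suc n) \<omega>) - W x) / (1 + W x) \<le> (\<alpha> n \<omega> * (grad W x \<bullet> v)
        + L * (\<alpha> n \<omega>)\<^sup>2 * (2 * (norm (h x))\<^sup>2 + 2 * (norm (M (Suc n) \<omega>))\<^sup>2)) / (1 + W x)"
      using W1[of x] by (intro divide_right_mono) (auto simp: less_imp_le)
    also have "\<dots> = \<alpha> n \<omega> * (G x \<bullet> h x) + D n \<omega>
        + 2 * L * ((\<alpha> n \<omega>)\<^sup>2 * (norm (h x))\<^sup>2 / (1 + W x)) + R n \<omega>"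
      by (simp add: G_def D_def X_def R_def Z_def v_def x_def inner_add_right add_divide_distrib algebra_simps)
    also have "2 * L * ((\<alpha> n \<omega>)\<^sup>2 * (norm (h x))\<^sup>2 / (1 + W x)) \<le> 2 * L * (B * (a n)\<^sup>2)"
    proof (rule mult_left_mono)
      have "(\<alpha> n \<omega>)\<^sup>2 * (norm (h x))\<^sup>2 / (1 + W x) \<le> (\<alpha> n \<omega>)\<^sup>2 * ((norm (h x))\<^sup>2 + f x) / (1 + W x)"
        using W1[of x] f[of x] by (intro divide_right_mono mult_left_mono) auto
      then show "(\<alpha> n \<omega>)\<^sup>2 * (norm (h x))\<^sup>2 / (1 + W x) \<le> B * (a n)\<^sup>2"
        using \<alpha>_B[of n \<omega>] unfolding x_def by linarith
    qed (use L(1) in simp)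
    finally show ?thesis
      using ln_add_one_le_tangent[OF W(3)[of x] W(3)[of "y (Suc n) \<omega>"]] unfolding x_def by linarith
  qed
  have q_cont: "continuous_on S (\<lambda>x. G x \<bullet> h x)" for S
    by (intro continuous_intros continuous_on_subset[OF G_cont] continuous_on_subset[OF h]) auto
  have q_neg: "G x \<bullet> h x < 0" if "W x \<ge> l" for x
    using drift[OF that] W1[of x] by (simp add: G_def divide_neg_pos inner_commute)
  obtain C where C: "\<And>x. W x < l \<Longrightarrow> G x \<bullet> h x \<le> C"
  proof -
    have "bounded ((\<lambda>x. G x \<bullet> h x) ` {x. W x \<le> l})"
      by (intro compact_imp_bounded compact_continuous_image q_cont compact_sublevel W_cont W(4))
    then obtain C where "\<And>x. W x \<le> l \<Longrightarrow> \<bar>G x \<bullet> h x\<bar> \<le> C" by (auto simp: bounded_iff)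
    then show ?thesis by (intro that[of C]) (force dest: less_imp_le)
  qed
  have unif: "\<exists>\<delta>>0. \<forall>n. l \<le> W (y n \<omega>) \<longrightarrow> W (y n \<omega>) \<le> r \<longrightarrow>
      \<alpha> n \<omega> * (G (y n \<omega>) \<bullet> h (y n \<omega>)) \<le> - \<delta> * a n" for r \<omega>
  proof (cases "{x. W x \<le> r} \<inter> {x. l \<le> W x} = {}")
    case True
    then show ?thesis by (intro exI[of _ 1]) auto
  next
    case False
    let ?K = "{x. W x \<le> r} \<inter> {x. l \<le> W x}"
    have K: "compact ?K"
      by (intro compact_Int_closed compact_sublevel W_cont W(4) closed_Collect_le continuous_on_const)
    obtain x0 where x0: "x0 \<in> ?K" "\<And>x. x \<in> ?K \<Longrightarrow> G x \<bullet> h x \<le> G x0 \<bullet> h x0"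
      using continuous_attains_sup[OF K False q_cont] by blast
    obtain b where b: "\<And>x. x \<in> ?K \<Longrightarrow> \<bar>g x\<bar> \<le> b"
      using locally_bounded_imp_bounded_image[OF g(2) K] by (auto simp: bounded_iff)
    have b1: "b \<ge> 1" using b[OF x0(1)] g(3)[of x0] by linarith
    \<comment> \<open>On the compact band the logarithmic drift has a negative maximum, attained at
      \<open>x0\<close>, and \<open>g \<le> b\<close> keeps the adapted step above
      \<open>a n / b\<close>; \<open>\<delta>\<close> combines the two.\<close>
    define \<delta> where "\<delta> = - (G x0 \<bullet> h x0) / b"
    have neg: "G x0 \<bullet> h x0 < 0" using x0(1) by (intro q_neg) auto
    then have "\<delta> > 0" using b1 by (simp add: \<delta>_def field_simps)
    moreover have "\<alpha> n \<omega> * (G (y n \<omega>) \<bullet> h (y n \<omega>)) \<le> - \<delta> * a n"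
      if "l \<le> W (y n \<omega>)" "W (y n \<omega>) \<le> r" for n
    proof -
      have inK: "y n \<omega> \<in> ?K" using that by auto
      have "\<alpha> n \<omega> * (G (y n \<omega>) \<bullet> h (y n \<omega>)) \<le> \<alpha> n \<omega> * (G x0 \<bullet> h x0)"
        using \<alpha>(1)[of n \<omega>] x0(2)[OF inK] by (intro mult_left_mono) auto
      also have "\<dots> \<le> (a n / b) * (G x0 \<bullet> h x0)"
      proof (rule mult_right_mono_neg)
        show "a n / b \<le> \<alpha> n \<omega>"
          unfolding \<alpha>_def using b[OF inK] g(3)[of "y n \<omega>"] a(1)[of n]
          by (intro divide_left_mono mult_pos_pos) auto
      qed (use neg in simp)
      also have "\<dots> = - \<delta> * a n" by (simp add: \<delta>_def)
      finally show ?thesis .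
    qed
    ultimately show ?thesis by blast
  qed
  show ?thesis
    using AE_D AE_R AE_space
  proof eventually_elim
    case (elim \<omega>)
    show ?case
    proof (rule perturbed_descent_eventually_less[where l = l and C = C and a = a
          and \<alpha> = "\<lambda>n. \<alpha> n \<omega>" and q = "\<lambda>n. G (y n \<omega>) \<bullet> h (y n \<omega>)"])
      show "summable (\<lambda>n. 2 * L * B * (a n)\<^sup>2 + R n \<omega> + D n \<omega>)"
        using elim by (intro summable_add summable_mult a(3))
      show "a \<longlonglongrightarrow> 0" by (rule summable_imp_tendsto_zero_of_squares[OF a(3)])
    qed (use W(3) lN step[OF elim(3)] \<alpha> a(2) C q_neg unif in \<open>auto simp: less_imp_le\<close>)
  qed
qed

text \<open>Above \<open>N\<close> the choice of \<open>g\<close> gives the bound directly; up to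
  height \<open>N\<close> it comes from compactness. The factor 1 + W, in place of W, covers points
  where \<open>W\<close> vanishes.\<close>

lemma squared_step_bound:
  fixes h :: "'a::euclidean_space \<Rightarrow> 'a" and W f g :: "'a \<Rightarrow> real" and N :: real
  assumes h: "continuous_on UNIV h" and f: "locally_bounded f"
    and W: "continuous_on UNIV W" "\<And>x. W x \<ge> 0" "filterlim W at_top at_infinity"
    and N: "N \<ge> 0"
    and g: "\<And>x. g x \<ge> 1" "\<And>x. W x > N \<Longrightarrow> g x \<ge> sqrt (((norm (h x))\<^sup>2 + f x) / W x)"
  obtains B where "\<And>x. (norm (h x))\<^sup>2 + f x \<le> B * (1 + W x) * (g x)\<^sup>2"
proof -
  let ?K = "{x. W x \<le> N}"
  have K: "compact ?K" by (rule compact_sublevel[OF W(1,3)])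
  have "bounded (h ` ?K)"
    by (intro compact_imp_bounded compact_continuous_image continuous_on_subset[OF h] K) simp
  then obtain b1 where b1: "\<And>x. W x \<le> N \<Longrightarrow> norm (h x) \<le> b1" by (auto simp: bounded_iff)
  obtain b2 where b2: "\<And>x. W x \<le> N \<Longrightarrow> \<bar>f x\<bar> \<le> b2"
    using locally_bounded_imp_bounded_image[OF f K] by (auto simp: bounded_iff)
  \<comment> \<open>The 1 serves the region above \<open>N\<close>, the other entry the compact
    sublevel set.\<close>
  define B where "B = max 1 (b1\<^sup>2 + b2)"
  have "(norm (h x))\<^sup>2 + f x \<le> B * (1 + W x) * (g x)\<^sup>2" for x
  proof (cases "W x \<le> N")
    case True
    have "(norm (h x))\<^sup>2 \<le> b1\<^sup>2" using b1[OF True] by (intro power_mono) auto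
    then have "(norm (h x))\<^sup>2 + f x \<le> B * 1 * 1" using b2[OF True] by (simp add: B_def)
    also have "\<dots> \<le> B * (1 + W x) * (g x)\<^sup>2"
      using W(2)[of x] g(1)[of x] by (intro mult_mono) (auto simp: B_def)
    finally show ?thesis .
  next
    case False
    then have Wx: "W x > 0" using N by linarith
    have "((norm (h x))\<^sup>2 + f x) / W x \<le> (g x)\<^sup>2"
      using g(2)[of x] False by (intro sqrt_le_D) auto
    then have "(norm (h x))\<^sup>2 + f x \<le> 1 * W x * (g x)\<^sup>2" using Wx by (simp add: field_simps)
    also have "\<dots> \<le> B * (1 + W x) * (g x)\<^sup>2"
      using Wx by (intro mult_right_mono mult_mono) (auto simp: B_def)
    finally show ?thesis .
  qed
  then show ?thesis by (rule that)
qed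

theorem proposition13:
  fixes P :: "'w measure"
    and h :: "real ^ 'd \<Rightarrow> real ^ 'd"
    and W f g :: "real ^ 'd \<Rightarrow> real"
    and a :: "nat \<Rightarrow> real"
    and M y :: "nat \<Rightarrow> 'w \<Rightarrow> real ^ 'd"
    and a_ad :: "nat \<Rightarrow> 'w \<Rightarrow> real"
    and m :: nat
    and N :: enat
  assumes "prob_space P"
    and a_pos: "\<And>n. a n > 0"
    and W_C1: "continuously_differentiable W"
    and y0_measurable: "y 0 \<in> borel_measurable P"
    and M_measurable: "\<And>n. n \<ge> 1 \<Longrightarrow> M n \<in> borel_measurable P"
    and A1: "locally_lipschitz h"
    and A2_i: "filterlim (\<lambda>n. \<Sum>k<n. a k) at_top sequentially"
    and A2_ii: "summable (\<lambda>n. (a n)\<^sup>2)"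
    and A3_i: "\<And>n. AE \<omega> in P.
      vector_cond_exp P (noise_filtration P (y 0) M n) (M (Suc n)) \<omega> = 0"
    and A3_ii_square_integrable: "\<And>n. n \<ge> 1 \<Longrightarrow> integrable P (\<lambda>\<omega>. (norm (M n \<omega>))\<^sup>2)"
    and A3_ii_f: "f \<in> borel_measurable borel" "locally_bounded f" "\<And>x. f x \<ge> 0"
    and A3_ii_bound: "\<And>n. AE \<omega> in P.
      real_cond_exp P (noise_filtration P (y 0) M n) (\<lambda>v. (norm (M (Suc n) v))\<^sup>2) \<omega> \<le> f (y n \<omega>)"
    and A4_i: "\<And>x. W x \<ge> 0" "filterlim W at_top at_infinity"
    and A4_ii: "m > 0" "\<And>x. W x \<ge> real m \<Longrightarrow> h x \<bullet> grad W x < 0"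
    and A5: "twice_continuously_differentiable W"
      "\<exists>C. \<forall>x. \<forall>i\<in>Basis. \<forall>j\<in>Basis. \<bar>partial_deriv i (partial_deriv j W) x\<bar> \<le> C"
    and m_less_N: "enat m < N"
    and c_N: "\<exists>c::real. ereal c > max 1
      (SUP x \<in> closure (sublevel W (ereal_of_enat N)) - sublevel W (ereal (real m)).
        ereal (((norm (h x))\<^sup>2 + f x) / W x))"
    and g_regular: "g \<in> borel_measurable borel" "locally_bounded g"
    and g_ge: "\<And>x. g x \<ge> max 1
      (if ereal (W x) > ereal_of_enat N then sqrt (((norm (h x))\<^sup>2 + f x) / W x) else 0)"
    and g_eq_1: "\<And>x. x \<in> sublevel W (ereal_of_enat N) \<Longrightarrow> g x = 1"
    and a_ad: "\<And>n \<omega>. \<omega> \<in> space P \<Longrightarrow> a_ad n \<omega> = a n / g (y n \<omega>)"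
    and y_Suc: "\<And>n \<omega>. \<omega> \<in> space P \<Longrightarrow>
      y (Suc n) \<omega> = y n \<omega> + a_ad n \<omega> *\<^sub>R (h (y n \<omega>) + M (Suc n) \<omega>)"
  shows "(AE \<omega> in P. finite {n. a_ad n \<omega> \<noteq> a n}) \<and>
    (AE \<omega> in P. filterlim (\<lambda>n. \<Sum>k<n. a_ad k \<omega>) at_top sequentially)"
proof -
  \<comment> \<open>The second claim follows path by path from the first, because changing finitely
    many terms does not affect divergence.\<close>
  have alltails: "filterlim (\<lambda>n. \<Sum>k<n. a_ad k \<omega>) at_top sequentially"
    if "finite {n. a_ad n \<omega> \<noteq> a n}" for \<omega>
    by (rule filterlim_partial_sums_cong[OF that A2_i])
  have "AE \<omega> in P. finite {n. a_ad n \<omega> \<noteq> a n}"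
  proof (cases N)
    case infinity
    \<comment> \<open>Every point lies in the sublevel set of height infinity, so \<open>g\<close>
      is 1 along the whole path.\<close>
    have "a_ad n \<omega> = a n" if "\<omega> \<in> space P" for n \<omega>
      using a_ad[OF that, of n] g_eq_1[of "y n \<omega>"] infinity by (simp add: sublevel_def)
    then show ?thesis by (intro AE_I2) simp
  next
    case (enat N')
    have mN: "real m < real N'" using m_less_N enat by simp
    have W_cont: "continuous_on UNIV W"
      by (rule continuously_differentiable_imp_continuous_on[OF W_C1])
    have h_cont: "continuous_on UNIV h" by (rule locally_lipschitz_imp_continuous_on[OF A1])
    have grad_C1: "continuously_differentiable (grad W)"
      using A5(1) by (simp add: twice_continuously_differentiable_def)
    obtain C where "\<And>x i j. i \<in> Basis \<Longrightarrow> j \<in> Basis \<Longrightarrow> \<bar>partial_deriv i (partial_deriv j W) x\<bar> \<le> C"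
      using A5(2) by blast
    then obtain L where L: "L > 0" "\<And>x y. norm (grad W x - grad W y) \<le> L * norm (x - y)"
      using grad_lipschitz[OF grad_C1] by blast
    have g1: "g x \<ge> 1" for x using g_ge[of x] by simp
    have g_sqrt: "g x \<ge> sqrt (((norm (h x))\<^sup>2 + f x) / W x)" if "W x > real N'" for x
      using g_ge[of x] that enat by simp
    obtain B where B: "\<And>x. (norm (h x))\<^sup>2 + f x \<le> B * (1 + W x) * (g x)\<^sup>2"
      using squared_step_bound[OF h_cont A3_ii_f(2) W_cont A4_i of_nat_0_le_iff g1 g_sqrt] by blast
    have rec: "y (Suc n) \<omega> = y n \<omega> + (a n / g (y n \<omega>)) *\<^sub>R (h (y n \<omega>) + M (Suc n) \<omega>)"
      if "\<omega> \<in> space P" for n \<omega>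
      using y_Suc[OF that, of n] a_ad[OF that, of n] by simp
    \<comment> \<open>The inner level is \<open>m\<close>, where the drift condition starts;
      \<open>m < N\<close> leaves the gap into which overshoot and noise must fit.\<close>
    have "AE \<omega> in P. eventually (\<lambda>n. W (y n \<omega>) < real N') sequentially"
      by (rule adapted_iterates_eventually_in_sublevel[OF \<open>prob_space P\<close> a_pos A2_i A2_ii
            y0_measurable M_measurable A3_i A3_ii_square_integrable A3_ii_bound h_cont A3_ii_f(3)
            W_C1 continuously_differentiable_imp_continuous_on[OF grad_C1] A4_i L
            of_nat_0_le_iff mN A4_ii(2) g_regular g1 B rec])
    then show ?thesis
      using AE_space
    proof eventually_elim
      case (elim \<omega>)
      have "eventually (\<lambda>n. a_ad n \<omega> = a n) sequentially"
        using elim(1)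
      proof eventually_elim
        case (elim n)
        then have "g (y n \<omega>) = 1" by (intro g_eq_1) (simp add: sublevel_def enat)
        then show ?case using a_ad[OF \<open>\<omega> \<in> space P\<close>, of n] by simp
      qed
      then show ?case by (simp add: eventually_cofinite flip: cofinite_eq_sequentially)
    qed
  qed
  then show ?thesis using alltails by (auto elim: eventually_mono)
qed

end
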